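(* Let $G$ be a countable abelian group acting continuously on a compact metric space $(X,d)$. Then the following three statements are equivalent: (1) the action $G\curvearrowright X$ is Banach-mean equicontinuous; (2) the action $G\curvearrowright X$ is Weyl-mean equicontinuous; (3) the action $G\curvearrowright X$ is Besicovitch-$\mathcal F$-mean equicontinuous for some left Følner sequence $\mathcal F$ of $G$.
   Context: $G$ is discrete; abelian groups are amenable. A (left) Følner sequence of $G$ is a sequence $\{F_n\}_{n\in\mathbb N}$ of nonempty finite subsets with $\lim_n |gF_n\triangle F_n|/|F_n|=0$ for all $g\in G$. Let $\mathrm{Fin}(G)$ be the family of nonempty finite subsets of $G$. For $x,y\in X$ and a Følner sequence $\mathcal F=\{F_n\}$ put $$\overline{D}(x,y)=\inf_{F\in \mathrm{Fin}(G)}\sup_{g\in G}\frac{1}{|F|}\sum_{t\in Fg}d(tx,ty),\qquad D_{\mathcal F}(x,y)=\limsup_{n\to\infty}\frac1{|F_n|}\sum_{g\in F_n}d(gx,gy),$$ $$D(x,y)=\sup\{D_{\mathcal F}(x,y):\mathcal F\text{ is a (left) Følner sequence of }G\}.$$ The action is Banach-mean (resp. Weyl-mean, resp. Besicovitch-$\mathcal F$-mean) equicontinuous if for every $\varepsilon>0$ there is $\delta>0$ such that $\overline D(x,y)<\varepsilon$ (resp. $D(x,y)<\varepsilon$, resp. $D_{\mathcal F}(x,y)<\varepsilon$) for all $x,y\in X$ with $d(x,y)<\delta$. *)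

theory Defs
  imports "HOL-Analysis.Analysis" "HOL-Algebra.Group_Action"
begin

text \<open>
  A group is a \<open>HOL-Algebra\<close> structure \<open>G\<close>, carrying the discrete topology. It acts on a
  subset \<open>X\<close> of a metric space through \<open>act\<close>, so that \<open>act g x\<close> is \<open>g\<close> applied to \<open>x\<close>. The quantities
  below take values in \<^typ>\<open>ereal\<close>, where all infima, suprema and upper limits exist; they are
  real-valued in the situation of interest, where \<open>X\<close> is compact and \<open>G\<close> is amenable.
\<close>

text \<open>As \<open>G\<close> is discrete, joint continuity of the action means continuity of each \<open>act g\<close>.
  The library's \<^locale>\<open>group_action\<close> requires \<open>act g\<close> to be \<open>undefined\<close> outside \<open>X\<close>; this only
  fixes the values of \<open>act g\<close> where the action is not defined anyway.\<close>

definition continuous_action ::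
  "('g, 'm) monoid_scheme \<Rightarrow> 'x::metric_space set \<Rightarrow> ('g \<Rightarrow> 'x \<Rightarrow> 'x) \<Rightarrow> bool" where
  "continuous_action G X act \<longleftrightarrow>
     group_action G X act \<and> (\<forall>g\<in>carrier G. continuous_on X (act g))"

definition Fin :: "('g, 'm) monoid_scheme \<Rightarrow> 'g set set" where
  "Fin G = {F. F \<subseteq> carrier G \<and> finite F \<and> F \<noteq> {}}"

definition left_Folner_seq :: "('g, 'm) monoid_scheme \<Rightarrow> (nat \<Rightarrow> 'g set) \<Rightarrow> bool" where
  "left_Folner_seq G \<F> \<longleftrightarrow>
     (\<forall>n. \<F> n \<in> Fin G) \<and>
     (\<forall>g\<in>carrier G.
        (\<lambda>n. real (card (sym_diff (g <#\<^bsub>G\<^esub> \<F> n) (\<F> n))) / real (card (\<F> n))) \<longlonglongrightarrow> 0)"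

definition Banach_mean_dist ::
  "('g, 'm) monoid_scheme \<Rightarrow> ('g \<Rightarrow> 'x \<Rightarrow> 'x::metric_space) \<Rightarrow> 'x \<Rightarrow> 'x \<Rightarrow> ereal" where
  "Banach_mean_dist G act x y =
     (INF F\<in>Fin G. SUP g\<in>carrier G.
        ereal (1 / real (card F) * (\<Sum>t\<in>F #>\<^bsub>G\<^esub> g. dist (act t x) (act t y))))"

definition Besicovitch_mean_dist ::
  "(nat \<Rightarrow> 'g set) \<Rightarrow> ('g \<Rightarrow> 'x \<Rightarrow> 'x::metric_space) \<Rightarrow> 'x \<Rightarrow> 'x \<Rightarrow> ereal" where
  "Besicovitch_mean_dist \<F> act x y =
     limsup (\<lambda>n. ereal (1 / real (card (\<F> n)) * (\<Sum>g\<in>\<F> n. dist (act g x) (act g y))))"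

definition Weyl_mean_dist ::
  "('g, 'm) monoid_scheme \<Rightarrow> ('g \<Rightarrow> 'x \<Rightarrow> 'x::metric_space) \<Rightarrow> 'x \<Rightarrow> 'x \<Rightarrow> ereal" where
  "Weyl_mean_dist G act x y =
     (SUP \<F>\<in>{\<F>. left_Folner_seq G \<F>}. Besicovitch_mean_dist \<F> act x y)"

definition Banach_mean_equicontinuous ::
  "('g, 'm) monoid_scheme \<Rightarrow> 'x::metric_space set \<Rightarrow> ('g \<Rightarrow> 'x \<Rightarrow> 'x) \<Rightarrow> bool" where
  "Banach_mean_equicontinuous G X act \<longleftrightarrow>
     (\<forall>\<epsilon>>0. \<exists>\<delta>>0. \<forall>x\<in>X. \<forall>y\<in>X. dist x y < \<delta> \<longrightarrow>
        Banach_mean_dist G act x y < ereal \<epsilon>)"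

definition Weyl_mean_equicontinuous ::
  "('g, 'm) monoid_scheme \<Rightarrow> 'x::metric_space set \<Rightarrow> ('g \<Rightarrow> 'x \<Rightarrow> 'x) \<Rightarrow> bool" where
  "Weyl_mean_equicontinuous G X act \<longleftrightarrow>
     (\<forall>\<epsilon>>0. \<exists>\<delta>>0. \<forall>x\<in>X. \<forall>y\<in>X. dist x y < \<delta> \<longrightarrow>
        Weyl_mean_dist G act x y < ereal \<epsilon>)"

definition Besicovitch_mean_equicontinuous ::
  "(nat \<Rightarrow> 'g set) \<Rightarrow> 'x::metric_space set \<Rightarrow> ('g \<Rightarrow> 'x \<Rightarrow> 'x) \<Rightarrow> bool" where
  "Besicovitch_mean_equicontinuous \<F> X act \<longleftrightarrow>
     (\<forall>\<epsilon>>0. \<exists>\<delta>>0. \<forall>x\<in>X. \<forall>y\<in>X. dist x y < \<delta> \<longrightarrow>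
        Besicovitch_mean_dist \<F> act x y < ereal \<epsilon>)"

end

theory Submission
  imports Defs "HOL-Real_Asymp.Real_Asymp"
begin

text \<open>
  The inequality \<open>D\<^sub>\<F> \<le> D-bar\<close> holds for every left Folner sequence because averaging over \<open>F\<close> first
  does not change averages along \<open>\<F>\<close> asymptotically; this gives (1) \<open>\<Rightarrow>\<close> (2), and (2) \<open>\<Rightarrow>\<close> (3)
  only needs some Folner sequence. For (3) \<open>\<Rightarrow>\<close> (1), let \<open>K\<close> be the set of pairs with
  \<open>D\<^sub>\<F> \<le> c\<close>. By equicontinuity \<open>K\<close> is closed, hence compact, and contains all sufficiently
  close pairs; as \<open>G\<close> is abelian, \<open>K\<close> is invariant. On \<open>K\<close> the averages \<open>A\<^sub>n d\<close> of the metric are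
  uniformly bounded continuous functions with \<open>limsup A\<^sub>n d \<le> c\<close> pointwise. Instead of the reverse
  Fatou lemma for invariant measures we use Simons' inequality: some infinite convex combination of
  the \<open>A\<^sub>n d\<close> is at most \<open>c + \<eta>\<close> uniformly on \<open>K\<close>. Averaging it once more along \<open>\<F>\<close> changes
  it asymptotically into \<open>A\<^sub>j d\<close>, uniformly on \<open>K\<close>, so \<open>A\<^sub>j d\<close> is uniformly small on whole orbits.
\<close>

section \<open>Simons' inequality\<close>

lemma halves_sums:
  fixes u :: "nat \<Rightarrow> real"
  assumes "\<And>k. \<bar>u k\<bar> \<le> M"
  shows "(\<lambda>k. u k / 2 ^ Suc k) sums (\<Sum>k. u k / 2 ^ Suc k)"
proof (rule summable_sums, rule summable_comparison_test')
  show "summable (\<lambda>k. (M / 2) * (1 / 2) ^ k)" by (intro summable_mult summable_geometric) simp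
  show "norm (u k / 2 ^ Suc k) \<le> (M / 2) * (1 / 2) ^ k" if "k \<ge> 0" for k
    using assms[of k] by (simp add: field_simps)
qed

lemma halves_const_sums: "(\<lambda>k. b / 2 ^ Suc k) sums (b::real)"
  using sums_mult[OF power_half_series, of b] by (simp add: power_divide)

lemma halves_le:
  fixes u :: "nat \<Rightarrow> real"
  assumes "\<And>k. \<bar>u k\<bar> \<le> M" "\<And>k. u k \<le> b"
  shows "(\<Sum>k. u k / 2 ^ Suc k) \<le> b"
  by (rule sums_le[OF _ halves_sums[OF assms(1)] halves_const_sums])
    (auto intro!: divide_right_mono assms)

lemma abs_halves_le:
  fixes u :: "nat \<Rightarrow> real"
  assumes "\<And>k. \<bar>u k\<bar> \<le> M"
  shows "\<bar>\<Sum>k. u k / 2 ^ Suc k\<bar> \<le> M"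
proof -
  have "- M \<le> u k" for k using assms[of k] by linarith
  then have "- M \<le> (\<Sum>k. u k / 2 ^ Suc k)"
    by (intro sums_le[OF _ halves_const_sums halves_sums[OF assms]]) (rule divide_right_mono, auto)
  moreover have "u k \<le> M" for k using assms[of k] by linarith
  ultimately show ?thesis using halves_le[OF assms] by (simp add: abs_le_iff)
qed

lemma halves_tendsto_0:
  fixes u :: "nat \<Rightarrow> nat \<Rightarrow> real"
  assumes "\<And>k j. \<bar>u k j\<bar> \<le> M" "\<And>k. (\<lambda>j. u k j) \<longlonglongrightarrow> 0"
  shows "(\<lambda>j. \<Sum>k. u k j / 2 ^ Suc k) \<longlonglongrightarrow> 0"
proof -
  have "(\<lambda>j. \<Sum>k. u k j / 2 ^ Suc k) \<longlonglongrightarrow> (\<Sum>k. 0 / 2 ^ Suc k)"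
  proof (intro tannerys_theorem[THEN conjunct2, THEN conjunct2])
    show "(\<lambda>j. u k j / 2 ^ Suc k) \<longlonglongrightarrow> 0 / 2 ^ Suc k" for k
      by (intro tendsto_divide assms tendsto_const) simp
    show "\<forall>\<^sub>F (k, j) in sequentially \<times>\<^sub>F sequentially. norm (u k j / 2 ^ Suc k) \<le> M / 2 ^ Suc k"
      using assms(1) by (intro always_eventually) (auto intro!: divide_right_mono simp: abs_divide)
    show "summable (\<lambda>k. M / 2 ^ Suc k)" using halves_const_sums by (rule sums_summable)
  qed simp
  then show ?thesis by simp
qed

text \<open>The gain is that one point \<open>x\<close> serves all \<open>n\<close>: a bound on the
  limsup at \<open>x\<close> alone then controls \<open>h\<close> on all of \<open>K\<close>. The
  function \<open>h\<close> is a dyadic combination of \<open>g n\<close> in \<open>C n\<close>,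
  chosen greedily so that each step nearly minimises the supremum over \<open>K\<close>. The point
  \<open>x\<close> maximises \<open>h\<close>, and the witness in \<open>C n\<close> is the rescaled
  tail of the series.\<close>

lemma simons_inequality:
  fixes C :: "nat \<Rightarrow> ('a::topological_space \<Rightarrow> real) set" and \<eta> M :: real
  assumes "compact K" "K \<noteq> {}" "\<eta> > 0"
    and ne: "\<And>n. C n \<noteq> {}"
    and decr: "\<And>n. C (Suc n) \<subseteq> C n"
    and cont: "\<And>n \<phi>. \<phi> \<in> C n \<Longrightarrow> continuous_on K \<phi>"
    and bound: "\<And>n \<phi> z. \<phi> \<in> C n \<Longrightarrow> z \<in> K \<Longrightarrow> \<bar>\<phi> z\<bar> \<le> M"
    and sigma_convex: "\<And>n g. (\<And>k. g k \<in> C n) \<Longrightarrow> (\<lambda>z. \<Sum>k. g k z / 2 ^ Suc k) \<in> C n"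
  shows "\<exists>h\<in>C 0. \<exists>x\<in>K. \<forall>n. \<exists>\<phi>\<in>C n. \<forall>z\<in>K. h z \<le> \<phi> x + \<eta>"
proof -
  define p where "p \<phi> = Sup (\<phi> ` K)" for \<phi> :: "'a \<Rightarrow> real"
  \<comment> \<open>The weight \<open>1 / 2 ^ n\<close> is the total weight still to be spent at
    stage \<open>n\<close>, so a candidate stands in for the whole remaining tail. Multiplied by
    \<open>2 ^ n\<close>, the tolerance becomes \<open>\<eta> / 2 ^ Suc n\<close>, and these errors
    add up to at most \<open>\<eta>\<close>.\<close>
  define opt where "opt n h g \<longleftrightarrow> g \<in> C n \<and>
      (\<forall>\<phi>\<in>C n. p (\<lambda>z. h z + g z / 2 ^ n) \<le> p (\<lambda>z. h z + \<phi> z / 2 ^ n) + \<eta> / (2 * 4 ^ n))"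
    for n :: nat and h g :: "'a \<Rightarrow> real"
  have scaled_bound: "\<bar>\<phi> z / 2 ^ n\<bar> \<le> M" if "\<phi> \<in> C m" "z \<in> K" for \<phi> z n m
  proof -
    have "\<bar>\<phi> z / 2 ^ n\<bar> \<le> \<bar>\<phi> z\<bar> / 1"
      unfolding abs_divide by (rule divide_left_mono) (auto simp: one_le_power)
    with bound[OF that] show ?thesis by simp
  qed
  have bdd: "bdd_above ((\<lambda>z. h z + \<phi> z / 2 ^ n) ` K)"
    if "\<And>z. z \<in> K \<Longrightarrow> \<bar>h z\<bar> \<le> B" "\<phi> \<in> C m" for h \<phi> B n m
  proof (rule bdd_aboveI2)
    show "h z + \<phi> z / 2 ^ n \<le> B + M" if "z \<in> K" for z
      using \<open>\<And>z. z \<in> K \<Longrightarrow> \<bar>h z\<bar> \<le> B\<close>[OF that] scaled_bound[OF \<open>\<phi> \<in> C m\<close> that, of n]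
      by linarith
  qed
  have opt_ex: "\<exists>g. opt n h g" if hB: "\<And>z. z \<in> K \<Longrightarrow> \<bar>h z\<bar> \<le> B" for n h B
  proof -
    obtain z0 where z0: "z0 \<in> K" using \<open>K \<noteq> {}\<close> by blast
    let ?S = "(\<lambda>\<phi>. p (\<lambda>z. h z + \<phi> z / 2 ^ n)) ` C n"
    have lower: "- B - M \<le> p (\<lambda>z. h z + \<phi> z / 2 ^ n)" if "\<phi> \<in> C n" for \<phi>
    proof -
      have "h z0 + \<phi> z0 / 2 ^ n \<le> p (\<lambda>z. h z + \<phi> z / 2 ^ n)"
        unfolding p_def by (rule cSUP_upper[OF z0 bdd[OF hB that]])
      then show ?thesis using hB[OF z0] scaled_bound[OF that z0, of n] by linarith
    qed
    then have bdd_below: "bdd_below ?S" by (auto intro!: bdd_belowI2)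
    have "0 < \<eta> / (2 * 4 ^ n)" using \<open>\<eta> > 0\<close> by simp
    then have "Inf ?S < Inf ?S + \<eta> / (2 * 4 ^ n)" by linarith
    then obtain g where g: "g \<in> C n"
      "p (\<lambda>z. h z + g z / 2 ^ n) < Inf ?S + \<eta> / (2 * 4 ^ n)"
      using cINF_less_iff[OF ne bdd_below] by blast
    have "Inf ?S \<le> p (\<lambda>z. h z + \<phi> z / 2 ^ n)" if "\<phi> \<in> C n" for \<phi>
      by (rule cINF_lower[OF bdd_below that])
    with g have "opt n h g" unfolding opt_def by fastforce
    then show ?thesis by blast
  qed
  \<comment> \<open>The choice of \<open>g n\<close> depends on the partial sum \<open>H n\<close>,
    so the partial sums are built first, by recursion, and \<open>g\<close> is read off. The chosen
    function enters with weight \<open>1 / 2 ^ Suc n\<close>, half of the weight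
    \<open>1 / 2 ^ n\<close> used when selecting it; the other half is left for later terms.\<close>
  define H where "H = rec_nat (\<lambda>_. 0) (\<lambda>n h z. h z + (SOME g. opt n h g) z / 2 ^ Suc n)"
  define g where "g n = (SOME g. opt n (H n) g)" for n
  have H_0: "H 0 z = 0" and H_Suc: "H (Suc n) z = H n z + g n z / 2 ^ Suc n" for n z
    by (simp_all add: H_def g_def)
  \<comment> \<open>Boundedness and near-optimality are proved together: \<open>g n\<close> exists
    because \<open>H n\<close> is bounded, and \<open>H (Suc n)\<close> is bounded because
    \<open>g n\<close> lies in \<open>C n\<close>.\<close>
  have H_g: "(\<exists>B. \<forall>z\<in>K. \<bar>H n z\<bar> \<le> B) \<and> opt n (H n) (g n)" for n
  proof (induction n)
    case 0
    have "\<exists>B. \<forall>z\<in>K. \<bar>H 0 z\<bar> \<le> B" by (auto simp: H_0)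
    then show ?case unfolding g_def by (metis opt_ex someI_ex)
  next
    case (Suc n)
    then obtain B where B: "\<And>z. z \<in> K \<Longrightarrow> \<bar>H n z\<bar> \<le> B" and "g n \<in> C n"
      unfolding opt_def by blast
    have "\<bar>H (Suc n) z\<bar> \<le> B + M" if "z \<in> K" for z
      using B[OF that] scaled_bound[OF \<open>g n \<in> C n\<close> that, of "Suc n"]
      unfolding H_Suc by linarith
    then have "\<exists>B. \<forall>z\<in>K. \<bar>H (Suc n) z\<bar> \<le> B" by blast
    then show ?case unfolding g_def by (metis opt_ex someI_ex)
  qed
  then have g_C: "g n \<in> C n" for n unfolding opt_def by blast
  \<comment> \<open>The tail from index \<open>n\<close> on, rescaled to total weight 1 so that it
    belongs to \<open>C n\<close>.\<close>
  define T where "T n z = (\<Sum>k. g (n + k) z / 2 ^ Suc k)" for n z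
  have C_mono: "C (n + k) \<subseteq> C n" for n k
    by (induction k) (use decr in auto)
  have T_C: "T n \<in> C n" for n
    unfolding T_def using sigma_convex[of "\<lambda>k. g (n + k)" n] g_C C_mono by blast
  have T_rec: "T n z = g n z / 2 + T (Suc n) z / 2" if "z \<in> K" for n z
  proof -
    have summable: "summable (\<lambda>k. g (m + k) z / 2 ^ Suc k)" for m
      by (rule sums_summable[OF halves_sums], rule bound[OF g_C \<open>z \<in> K\<close>])
    have "T n z = g n z / 2 + (\<Sum>k. g (Suc n + k) z / 2 ^ Suc k / 2)"
      using suminf_split_head[OF summable[of n]] by (simp add: T_def mult.commute)
    also have "(\<Sum>k. g (Suc n + k) z / 2 ^ Suc k / 2) = T (Suc n) z / 2"
      unfolding T_def by (rule suminf_divide[OF summable])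
    finally show ?thesis .
  qed
  have H_T: "T 0 z = H n z + T n z / 2 ^ n" if "z \<in> K" for n z
  proof (induction n)
    case (Suc n)
    then show ?case using T_rec[OF that, of n] by (simp add: H_Suc field_simps)
  qed (simp add: H_0)
  have "continuous_on K (T 0)" using T_C cont by blast
  then obtain x where x: "x \<in> K" "\<And>z. z \<in> K \<Longrightarrow> T 0 z \<le> T 0 x"
    using continuous_attains_sup[OF \<open>compact K\<close> \<open>K \<noteq> {}\<close>] by blast
  txt \<open>\<open>T n\<close> was a competitor of the nearly optimal \<open>g n\<close>, and \<open>H n + T n / 2^n = T 0\<close>; hence at
    a maximum point of \<open>T 0\<close> the values \<open>T n x\<close> essentially increase with \<open>n\<close>.\<close>
  have step: "T n x \<le> T (Suc n) x + \<eta> / 2 ^ Suc n" for n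
  proof -
    obtain B where B: "\<And>z. z \<in> K \<Longrightarrow> \<bar>H n z\<bar> \<le> B" using H_g by blast
    have "H n x + g n x / 2 ^ n \<le> p (\<lambda>z. H n z + g n z / 2 ^ n)"
      unfolding p_def by (rule cSUP_upper[OF x(1) bdd[OF B g_C]])
    also have "\<dots> \<le> p (\<lambda>z. H n z + T n z / 2 ^ n) + \<eta> / (2 * 4 ^ n)"
      using H_g[of n] T_C[of n] unfolding opt_def by blast
    also have "p (\<lambda>z. H n z + T n z / 2 ^ n) = p (T 0)"
      unfolding p_def by (metis (no_types, lifting) H_T image_cong)
    also have "p (T 0) \<le> T 0 x"
      unfolding p_def using \<open>K \<noteq> {}\<close> x(2) by (auto intro!: cSUP_least)
    also have "T 0 x = H n x + T n x / 2 ^ n" by (rule H_T[OF x(1)])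
    finally have "g n x / 2 ^ n \<le> T n x / 2 ^ n + \<eta> / (2 * 4 ^ n)" by simp
    then have "g n x / 2 ^ n * 2 ^ n \<le> (T n x / 2 ^ n + \<eta> / (2 * 4 ^ n)) * 2 ^ n"
      by (rule mult_right_mono) simp
    moreover have "(4::real) ^ n = 2 ^ n * 2 ^ n" by (simp add: power_mult_distrib[symmetric])
    ultimately have "g n x \<le> T n x + \<eta> / 2 ^ Suc n" by (simp add: distrib_right)
    then show ?thesis using T_rec[OF x(1), of n] by linarith
  qed
  have "T 0 x \<le> T n x + \<eta> * (1 - 1 / 2 ^ n)" for n
  proof (induction n)
    case (Suc n)
    have "\<eta> * (1 - 1 / 2 ^ n) + \<eta> / 2 ^ Suc n = \<eta> * (1 - 1 / 2 ^ Suc n)"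
      by (simp add: field_simps)
    with Suc step[of n] show ?case by linarith
  qed simp
  moreover have "\<eta> * (1 - 1 / 2 ^ n) \<le> \<eta>" for n :: nat using \<open>\<eta> > 0\<close> by simp
  ultimately have "T 0 x \<le> T n x + \<eta>" for n by (meson add_left_mono order_trans)
  then show ?thesis using T_C x by (meson order_trans)
qed

section \<open>Averages along Folner sequences\<close>

definition mean :: "'g set \<Rightarrow> ('g \<Rightarrow> 'z \<Rightarrow> 'z) \<Rightarrow> ('z \<Rightarrow> real) \<Rightarrow> 'z \<Rightarrow> real" where
  "mean F T \<phi> z = (\<Sum>t\<in>F. \<phi> (T t z)) / real (card F)"

lemma mean_le:
  assumes "finite F" "F \<noteq> {}" "\<And>t. t \<in> F \<Longrightarrow> \<phi> (T t z) \<le> c"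
  shows "mean F T \<phi> z \<le> c"
  using sum_mono[of F "\<lambda>t. \<phi> (T t z)" "\<lambda>_. c"] assms
  by (simp add: mean_def divide_le_eq card_gt_0_iff mult.commute)

lemma mean_ge:
  assumes "finite F" "F \<noteq> {}" "\<And>t. t \<in> F \<Longrightarrow> c \<le> \<phi> (T t z)"
  shows "c \<le> mean F T \<phi> z"
  using sum_mono[of F "\<lambda>_. c" "\<lambda>t. \<phi> (T t z)"] assms
  by (simp add: mean_def le_divide_eq card_gt_0_iff mult.commute)

lemma abs_mean_le:
  assumes "finite F" "F \<noteq> {}" "\<And>t. t \<in> F \<Longrightarrow> \<bar>\<phi> (T t z)\<bar> \<le> c"
  shows "\<bar>mean F T \<phi> z\<bar> \<le> c"
  using mean_le[OF assms(1,2), of \<phi> T z c] mean_ge[OF assms(1,2), of "- c" \<phi> T z] assms(3)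
  by (simp add: abs_le_iff minus_le_iff)

lemma abs_sum_diff_le:
  fixes u :: "'a \<Rightarrow> real"
  assumes "finite A" "finite B" "\<And>x. x \<in> A \<union> B \<Longrightarrow> \<bar>u x\<bar> \<le> M"
  shows "\<bar>sum u A - sum u B\<bar> \<le> M * real (card (sym_diff A B))"
proof -
  have "sum u A - sum u B = sum u (A - B) - sum u (B - A)"
    using sum.Int_Diff[OF assms(1), of u B] sum.Int_Diff[OF assms(2), of u A]
    by (simp add: Int_commute)
  also have "\<bar>\<dots>\<bar> \<le> (\<Sum>x\<in>A - B. \<bar>u x\<bar>) + (\<Sum>x\<in>B - A. \<bar>u x\<bar>)"
    by (intro order_trans[OF abs_triangle_ineq4] add_mono sum_abs)
  also have "\<dots> = (\<Sum>x\<in>sym_diff A B. \<bar>u x\<bar>)"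
    using assms by (intro sum.union_disjoint[symmetric]) auto
  also have "\<dots> \<le> (\<Sum>x\<in>sym_diff A B. M)"
    using assms(3) by (intro sum_mono) auto
  finally show ?thesis by (simp add: mult.commute)
qed

text \<open>\<open>K\<close> is left abstract because two choices are made later: all of
  \<open>X \<times> X\<close>, and the compact invariant set of mean-close pairs.\<close>

locale folner_action = group G for G (structure) +
  fixes K :: "'z::topological_space set" and T :: "'a \<Rightarrow> 'z \<Rightarrow> 'z" and \<F> :: "nat \<Rightarrow> 'a set"
  assumes folner: "left_Folner_seq G \<F>"
    and T_closed: "g \<in> carrier G \<Longrightarrow> z \<in> K \<Longrightarrow> T g z \<in> K"
    and T_mult: "g \<in> carrier G \<Longrightarrow> h \<in> carrier G \<Longrightarrow> z \<in> K \<Longrightarrow> T (g \<otimes> h) z = T g (T h z)"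
begin

lemma folner_Fin: "finite (\<F> n)" "\<F> n \<noteq> {}" "\<F> n \<subseteq> carrier G"
  using folner by (auto simp: left_Folner_seq_def Fin_def)

lemma folner_carrier: "t \<in> \<F> n \<Longrightarrow> t \<in> carrier G"
  using folner_Fin by blast

lemma card_folner_pos: "real (card (\<F> n)) > 0"
  using folner_Fin by (simp add: card_gt_0_iff)

text \<open>Composing \<open>\<phi>\<close> with \<open>T t\<close> replaces the index set
  \<open>\<F> n\<close> by its left translate; the terms common to both sets cancel, leaving the
  symmetric difference.\<close>

lemma mean_shift_diff:
  assumes "t \<in> carrier G" "z \<in> K" "\<And>z. z \<in> K \<Longrightarrow> \<bar>\<phi> z\<bar> \<le> M"
  shows "\<bar>mean (\<F> n) T (\<lambda>z. \<phi> (T t z)) z - mean (\<F> n) T \<phi> z\<bar>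
    \<le> M * (real (card (sym_diff (t <#\<^bsub>G\<^esub> \<F> n) (\<F> n))) / real (card (\<F> n)))"
proof -
  have shift: "t <#\<^bsub>G\<^esub> \<F> n = (\<lambda>e. t \<otimes> e) ` \<F> n" by (auto simp: l_coset_def)
  have inj: "inj_on (\<lambda>e. t \<otimes> e) (\<F> n)"
    using inj_on_subset[OF inj_on_cmult[OF assms(1)] folner_Fin(3)] .
  have "(\<Sum>e\<in>\<F> n. \<phi> (T t (T e z))) = (\<Sum>e\<in>t <#\<^bsub>G\<^esub> \<F> n. \<phi> (T e z))"
    unfolding shift sum.reindex[OF inj] o_def
    using assms folner_carrier by (intro sum.cong) (auto simp: T_mult)
  moreover have "\<bar>(\<Sum>e\<in>t <#\<^bsub>G\<^esub> \<F> n. \<phi> (T e z)) - (\<Sum>e\<in>\<F> n. \<phi> (T e z))\<bar>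
      \<le> M * real (card (sym_diff (t <#\<^bsub>G\<^esub> \<F> n) (\<F> n)))"
    using assms folner_Fin folner_carrier
    by (intro abs_sum_diff_le) (auto simp: shift intro!: assms(3) T_closed)
  ultimately show ?thesis
    using card_folner_pos[of n]
    by (simp add: mean_def diff_divide_distrib[symmetric] abs_divide divide_right_mono)
qed

text \<open>Quantifying over all sequences \<open>w\<close> in \<open>K\<close> expresses uniformity of the convergence.\<close>

lemma mean_mean_tendsto:
  assumes E: "finite E" "E \<noteq> {}" "E \<subseteq> carrier G"
    and \<phi>: "\<And>z. z \<in> K \<Longrightarrow> \<bar>\<phi> z\<bar> \<le> M" and w: "\<And>j. w j \<in> K"
  shows "(\<lambda>j. mean (\<F> j) T (mean E T \<phi>) (w j) - mean (\<F> j) T \<phi> (w j)) \<longlonglongrightarrow> 0"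
proof -
  \<comment> \<open>Exchanging the two sums shows that the difference in question is the average of
    \<open>D t j\<close> over the finite set \<open>E\<close>, so it is enough that each
    \<open>D t\<close> tends to 0.\<close>
  define D where "D t j = mean (\<F> j) T (\<lambda>z. \<phi> (T t z)) (w j) - mean (\<F> j) T \<phi> (w j)" for t j
  have "(\<lambda>j. D t j) \<longlonglongrightarrow> 0" if "t \<in> E" for t
  proof (rule Lim_null_comparison)
    have t: "t \<in> carrier G" using that E by blast
    show "\<forall>\<^sub>F j in sequentially. norm (D t j)
        \<le> M * (real (card (sym_diff (t <#\<^bsub>G\<^esub> \<F> j) (\<F> j))) / real (card (\<F> j)))"
      unfolding D_def real_norm_def by (intro always_eventually allI mean_shift_diff t w \<phi>)
    show "(\<lambda>j. M * (real (card (sym_diff (t <#\<^bsub>G\<^esub> \<F> j) (\<F> j))) / real (card (\<F> j)))) \<longlonglongrightarrow> 0"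
      using folner t by (intro tendsto_mult_right_zero) (auto simp: left_Folner_seq_def)
  qed
  then have "(\<lambda>j. (\<Sum>t\<in>E. D t j) / real (card E)) \<longlonglongrightarrow> (\<Sum>t\<in>E. 0) / real (card E)"
    by (intro tendsto_divide tendsto_sum tendsto_const) (use E in auto)
  moreover have "(\<Sum>t\<in>E. D t j) / real (card E)
      = mean (\<F> j) T (mean E T \<phi>) (w j) - mean (\<F> j) T \<phi> (w j)" for j
  proof -
    have "(\<Sum>t\<in>E. mean (\<F> j) T (\<lambda>z. \<phi> (T t z)) (w j)) / real (card E)
        = mean (\<F> j) T (mean E T \<phi>) (w j)"
      unfolding mean_def sum_divide_distrib[symmetric]
      by (subst sum.swap) (simp add: mult.commute)
    then show ?thesis
      using E by (simp add: D_def sum_subtractf diff_divide_distrib)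
  qed
  ultimately show ?thesis by simp
qed


text \<open>A single index \<open>j\<close> suffices later, since the Banach distance is an infimum
  over finite sets and \<open>\<F> j\<close> can be used as a competitor.\<close>

theorem uniform_mean_bound:
  assumes K: "compact K" "K \<noteq> {}"
    and T: "\<And>g. g \<in> carrier G \<Longrightarrow> continuous_on K (T g)"
    and \<phi>: "continuous_on K \<phi>"
    and lim: "\<And>z \<eta>. z \<in> K \<Longrightarrow> \<eta> > 0 \<Longrightarrow> \<forall>\<^sub>F n in sequentially. mean (\<F> n) T \<phi> z \<le> c + \<eta>"
    and "\<eta> > 0"
  shows "\<exists>j. \<forall>z\<in>K. mean (\<F> j) T \<phi> z \<le> c + \<eta>"
proof -
  obtain M where M: "\<And>z. z \<in> K \<Longrightarrow> \<bar>\<phi> z\<bar> \<le> M"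
    using compact_imp_bounded[OF compact_continuous_image[OF \<phi> K(1)]]
    by (auto simp: bounded_iff)
  \<comment> \<open>Instead of explicit infinite convex combinations of the means with index at
    least \<open>n\<close>, \<open>C n\<close> collects properties they share and which pass to
    dyadic series: continuity, the bound \<open>M\<close>, being pointwise below every upper bound
    of the later means, and having asymptotically the same means as \<open>\<phi>\<close>, uniformly
    on \<open>K\<close>.\<close>
  define C where "C n = {\<psi>. continuous_on K \<psi> \<and> (\<forall>z\<in>K. \<bar>\<psi> z\<bar> \<le> M) \<and>
      (\<forall>z\<in>K. \<forall>b. (\<forall>k\<ge>n. mean (\<F> k) T \<phi> z \<le> b) \<longrightarrow> \<psi> z \<le> b) \<and>
      (\<forall>w. (\<forall>j. w j \<in> K) \<longrightarrow>
        (\<lambda>j. mean (\<F> j) T \<psi> (w j) - mean (\<F> j) T \<phi> (w j)) \<longlonglongrightarrow> 0)}" for n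
  have mean_C: "mean (\<F> n) T \<phi> \<in> C n" for n
  proof -
    have "continuous_on K (\<lambda>z. \<phi> (T t z))" if "t \<in> \<F> n" for t
      using that by (intro continuous_on_compose2[OF \<phi> T]) (auto simp: folner_carrier T_closed)
    then have "continuous_on K (mean (\<F> n) T \<phi>)"
      unfolding mean_def using card_folner_pos[of n] by (intro continuous_intros) auto
    moreover have "\<bar>mean (\<F> n) T \<phi> z\<bar> \<le> M" if "z \<in> K" for z
      by (intro abs_mean_le M folner_Fin T_closed that folner_carrier)
    ultimately show ?thesis
      unfolding C_def mem_Collect_eq
      by (intro conjI ballI allI impI mean_mean_tendsto[OF folner_Fin M]) auto
  qed
  \<comment> \<open>The budget \<open>\<eta>\<close> is split in three: one third for Simons'
    inequality, one for the limsup at \<open>x\<close>, and one as the gap in the final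
    contradiction.\<close>
  have "\<exists>h\<in>C 0. \<exists>x\<in>K. \<forall>n. \<exists>\<psi>\<in>C n. \<forall>z\<in>K. h z \<le> \<psi> x + \<eta> / 3"
  proof (rule simons_inequality[OF K])
    show "\<eta> / 3 > 0" using \<open>\<eta> > 0\<close> by simp
    show "C n \<noteq> {}" for n using mean_C by blast
    show "C (Suc n) \<subseteq> C n" for n unfolding C_def using Suc_leD by blast
    show "continuous_on K \<psi>" if "\<psi> \<in> C n" for n \<psi> using that by (simp add: C_def)
    show "\<bar>\<psi> z\<bar> \<le> M" if "\<psi> \<in> C n" "z \<in> K" for n \<psi> z using that by (simp add: C_def)
    show "(\<lambda>z. \<Sum>k. g k z / 2 ^ Suc k) \<in> C n" if g: "\<And>k. g k \<in> C n" for n g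
    proof -
      let ?\<psi> = "\<lambda>z. \<Sum>k. g k z / 2 ^ Suc k"
      have g_cont: "continuous_on K (g k)" for k using g by (simp add: C_def)
      have g_bound: "\<bar>g k z\<bar> \<le> M" if "z \<in> K" for k z using g that by (simp add: C_def)
      have "uniform_limit K (\<lambda>m z. \<Sum>k<m. g k z / 2 ^ Suc k) ?\<psi> sequentially"
      proof (rule Weierstrass_m_test)
        show "norm (g k z / 2 ^ Suc k) \<le> M / 2 ^ Suc k" if "z \<in> K" for k z
          using g_bound[OF that] by (simp add: abs_divide divide_right_mono)
        show "summable (\<lambda>k. M / 2 ^ Suc k)" using halves_const_sums by (rule sums_summable)
      qed
      then have "continuous_on K ?\<psi>"
        by (rule uniform_limit_theorem[rotated])
           (auto intro!: always_eventually continuous_intros g_cont)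
      moreover have "\<bar>?\<psi> z\<bar> \<le> M" if "z \<in> K" for z
        by (rule abs_halves_le) (rule g_bound[OF that])
      moreover have "?\<psi> z \<le> b" if "z \<in> K" "\<forall>k\<ge>n. mean (\<F> k) T \<phi> z \<le> b" for z b
      proof (rule halves_le)
        show "\<bar>g k z\<bar> \<le> M" for k by (rule g_bound[OF that(1)])
        show "g k z \<le> b" for k using g[of k] that by (simp add: C_def)
      qed
      moreover have "(\<lambda>j. mean (\<F> j) T ?\<psi> (w j) - mean (\<F> j) T \<phi> (w j)) \<longlonglongrightarrow> 0"
        if w: "\<And>j. w j \<in> K" for w
      proof -
        define u where "u k j = mean (\<F> j) T (g k) (w j) - mean (\<F> j) T \<phi> (w j)" for k j
        have mean_sums: "(\<lambda>k. mean (\<F> j) T (g k) (w j) / 2 ^ Suc k) sums mean (\<F> j) T ?\<psi> (w j)" for j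
        proof -
          have "(\<lambda>k. (\<Sum>t\<in>\<F> j. g k (T t (w j)) / 2 ^ Suc k) / real (card (\<F> j)))
              sums mean (\<F> j) T ?\<psi> (w j)"
            unfolding mean_def
            by (intro sums_divide sums_sum halves_sums[of _ M] g_bound T_closed w folner_carrier)
          then show ?thesis
            by (simp add: mean_def sum_divide_distrib[symmetric] mult.commute)
        qed
        \<comment> \<open>As the weights sum to 1, the fixed term
          \<open>mean (\<F> j) T \<phi> (w j)\<close> can be distributed over the series.\<close>
        have "(\<lambda>k. u k j / 2 ^ Suc k) sums (mean (\<F> j) T ?\<psi> (w j) - mean (\<F> j) T \<phi> (w j))" for j
          using sums_diff[OF mean_sums halves_const_sums, of j "mean (\<F> j) T \<phi> (w j)"]
          by (simp add: u_def diff_divide_distrib)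
        moreover have "(\<lambda>j. \<Sum>k. u k j / 2 ^ Suc k) \<longlonglongrightarrow> 0"
        proof (rule halves_tendsto_0)
          show "\<bar>u k j\<bar> \<le> M + M" for k j
            unfolding u_def
            by (intro order_trans[OF abs_triangle_ineq4] add_mono abs_mean_le folner_Fin g_bound M
                T_closed w folner_carrier)
          show "(\<lambda>j. u k j) \<longlonglongrightarrow> 0" for k
            using g[of k] w unfolding C_def u_def by blast
        qed
        ultimately show ?thesis by (simp add: sums_iff)
      qed
      ultimately show ?thesis
        unfolding C_def mem_Collect_eq by (intro conjI ballI allI impI) auto
    qed
  qed
  then obtain h x where h: "h \<in> C 0" and x: "x \<in> K"
    and hx: "\<And>n. \<exists>\<psi>\<in>C n. \<forall>z\<in>K. h z \<le> \<psi> x + \<eta> / 3" by blast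
  \<comment> \<open>\<open>N\<close> may be chosen after \<open>x\<close>, because \<open>x\<close>
    does not depend on \<open>n\<close>; only the limsup bound at \<open>x\<close> enters, yet
    \<open>z\<close> is arbitrary.\<close>
  have h_le: "h z \<le> c + 2 * \<eta> / 3" if "z \<in> K" for z
  proof -
    obtain N where N: "\<forall>n\<ge>N. mean (\<F> n) T \<phi> x \<le> c + \<eta> / 3"
      using lim[OF x, of "\<eta> / 3"] \<open>\<eta> > 0\<close> by (auto simp: eventually_sequentially)
    obtain \<psi> where "\<psi> \<in> C N" and \<psi>: "h z \<le> \<psi> x + \<eta> / 3" using hx \<open>z \<in> K\<close> by blast
    then have "\<psi> x \<le> c + \<eta> / 3" using N x by (simp add: C_def)
    with \<psi> show ?thesis by simp
  qed
  show ?thesis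
  proof (rule ccontr)
    assume "\<not> ?thesis"
    \<comment> \<open>A bad point for every \<open>j\<close> forms a sequence in \<open>K\<close>,
      to which the uniform asymptotic clause of \<open>C 0\<close> applies.\<close>
    then obtain w where w: "\<And>j. w j \<in> K" "\<And>j. mean (\<F> j) T \<phi> (w j) > c + \<eta>"
      by (metis not_le)
    have "(\<lambda>j. mean (\<F> j) T h (w j) - mean (\<F> j) T \<phi> (w j)) \<longlonglongrightarrow> 0"
      using h w(1) by (simp add: C_def)
    moreover have "mean (\<F> j) T h (w j) - mean (\<F> j) T \<phi> (w j) \<le> - \<eta> / 3" for j
    proof -
      have "mean (\<F> j) T h (w j) \<le> c + 2 * \<eta> / 3"
        by (intro mean_le folner_Fin h_le T_closed w(1) folner_carrier)
      with w(2)[of j] show ?thesis by (simp add: field_simps)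
    qed
    ultimately have "0 \<le> - \<eta> / 3" by (meson LIMSEQ_le_const2)
    with \<open>\<eta> > 0\<close> show False by simp
  qed
qed

end

section \<open>Folner sequences in countable abelian groups\<close>

context comm_group
begin

text \<open>The image in \<open>G\<close> of the cube \<open>{0..N}^n\<close> under the homomorphism
  from the free abelian group on \<open>n\<close> generators to \<open>G\<close> given by
  \<open>e 0, ..., e (n - 1)\<close>. Different exponent vectors may collide, so its size is only
  bounded above by that of the cube.\<close>

primrec power_box :: "(nat \<Rightarrow> 'a) \<Rightarrow> nat \<Rightarrow> nat \<Rightarrow> 'a set" where
  "power_box e 0 N = {\<one>}"
| "power_box e (Suc n) N = (\<lambda>(k, b). e n [^] k \<otimes> b) ` ({..N} \<times> power_box e n N)"

lemma power_box_Fin: "(\<And>i. e i \<in> carrier G) \<Longrightarrow> power_box e n N \<in> Fin G"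
  by (induction n) (auto simp: Fin_def)

lemma card_power_box:
  assumes "\<And>i. e i \<in> carrier G"
  shows "card (power_box e n N) \<le> Suc N ^ n"
proof (induction n)
  case (Suc n)
  have "finite (power_box e n N)" using power_box_Fin[of e n N, OF assms] by (auto simp: Fin_def)
  then have "card (power_box e (Suc n) N) \<le> card ({..N} \<times> power_box e n N)"
    unfolding power_box.simps by (intro card_image_le) simp
  also have "\<dots> \<le> Suc N * Suc N ^ n"
    unfolding card_cartesian_product by (rule mult_le_mono) (use Suc in auto)
  finally show ?case by simp
qed simp

lemma power_box_mono: "N \<le> N' \<Longrightarrow> power_box e n N \<subseteq> power_box e n N'"
proof (induction n)
  case (Suc n)
  then show ?case unfolding power_box.simps by (intro image_mono Sigma_mono) auto
qed simp

text \<open>By commutativity the factor \<open>e i\<close> moves to its own power and raises that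
  exponent by one.\<close>

lemma power_box_mult:
  assumes e: "\<And>i. e i \<in> carrier G" and "i < n" "b \<in> power_box e n N"
  shows "e i \<otimes> b \<in> power_box e n (Suc N)"
  using assms(2,3)
proof (induction n arbitrary: b)
  case (Suc n)
  then obtain k b' where b: "b = e n [^] k \<otimes> b'" "k \<le> N" "b' \<in> power_box e n N" by auto
  then have b': "b' \<in> carrier G" using power_box_Fin[of e n N, OF e] by (auto simp: Fin_def)
  show ?case
  proof (cases "i = n")
    case True
    have "e i \<otimes> b = e n [^] Suc k \<otimes> b'"
      using e b' by (simp add: b True m_ac)
    moreover have "b' \<in> power_box e n (Suc N)" using b(3) power_box_mono[of N "Suc N"] by auto
    ultimately show ?thesis using b(2) by force
  next
    case False
    then have "e i \<otimes> b' \<in> power_box e n (Suc N)" using Suc b by simp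
    moreover have "e i \<otimes> b = e n [^] k \<otimes> (e i \<otimes> b')"
      using e b' by (simp add: b m_lcomm)
    ultimately show ?thesis using b(2) by force
  qed
qed simp

text \<open>A box with \<open>|B (N + 1)| \<le> (1 + \<eta>) |B N|\<close> exists because \<open>|B N|\<close> grows polynomially.\<close>

lemma almost_invariant_power_box:
  assumes e: "\<And>i. e i \<in> carrier G" and "\<eta> > 0"
  shows "\<exists>N. \<forall>i<n. real (card (sym_diff (e i <#\<^bsub>G\<^esub> power_box e n N) (power_box e n N)))
    \<le> 2 * \<eta> * real (card (power_box e n N))"
proof -
  let ?B = "power_box e n"
  have Fin: "finite (?B N)" "?B N \<noteq> {}" "?B N \<subseteq> carrier G" for N
    using power_box_Fin[of e n N, OF e] by (auto simp: Fin_def)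
  have "\<exists>N. real (card (?B (Suc N))) \<le> (1 + \<eta>) * real (card (?B N))"
  proof (rule ccontr)
    assume "\<not> ?thesis"
    then have step: "(1 + \<eta>) * real (card (?B N)) \<le> real (card (?B (Suc N)))" for N
      by (meson le_cases)
    have "(1 + \<eta>) ^ N \<le> real (card (?B N))" for N
    proof (induction N)
      case 0
      show ?case using Fin[of 0] by (simp add: Suc_le_eq card_gt_0_iff)
    next
      case (Suc N)
      have "(1 + \<eta>) ^ Suc N \<le> (1 + \<eta>) * real (card (?B N))" using Suc \<open>\<eta> > 0\<close> by simp
      with step[of N] show ?case by linarith
    qed
    also have "real (card (?B N)) \<le> (real N + 1) ^ n" for N
      using card_power_box[of e n N, OF e] by (metis of_nat_Suc of_nat_le_iff of_nat_power add.commute)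
    finally have "(1 + \<eta>) ^ N \<le> (real N + 1) ^ n" for N .
    moreover have "\<forall>\<^sub>F N in sequentially. (real N + 1) ^ n < (1 + \<eta>) ^ N"
      using \<open>\<eta> > 0\<close> by real_asymp
    ultimately show False by (auto simp: eventually_sequentially not_less[symmetric])
  qed
  then obtain N where N: "real (card (?B (Suc N))) \<le> (1 + \<eta>) * real (card (?B N))" ..
  have "real (card (sym_diff (e i <#\<^bsub>G\<^esub> ?B N) (?B N))) \<le> 2 * \<eta> * real (card (?B N))" if "i < n" for i
  proof -
    let ?S = "e i <#\<^bsub>G\<^esub> ?B N"
    have shift: "?S = (\<lambda>b. e i \<otimes> b) ` ?B N" by (auto simp: l_coset_def)
    have card_S: "card ?S = card (?B N)"
      unfolding shift by (rule card_image[OF inj_on_subset[OF inj_on_cmult[OF e] Fin(3)]])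
    have fin_S: "finite ?S" unfolding shift using Fin by simp
    \<comment> \<open>The shift has the same size as the box, and their union has at most
      \<open>(1 + \<eta>)\<close> times that size; so each one-sided difference is at most
      \<open>\<eta>\<close> times it, whence the factor 2.\<close>
    have "?S \<union> ?B N \<subseteq> ?B (Suc N)"
      using power_box_mult[OF e that] power_box_mono[of N "Suc N"] by (auto simp: shift)
    then have "card (?S \<union> ?B N) \<le> card (?B (Suc N))" by (rule card_mono[OF Fin(1)])
    then have union: "real (card (?S \<union> ?B N)) \<le> (1 + \<eta>) * real (card (?B N))" using N by linarith
    have "card (?S \<union> ?B N) = card (?S - ?B N) + card (?B N)"
      using card_Un_disjoint[of "?S - ?B N" "?B N"] fin_S Fin by auto
    moreover have "card (?S \<union> ?B N) = card (?B N - ?S) + card ?S"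
      using card_Un_disjoint[of "?B N - ?S" ?S] fin_S Fin by (auto simp: Un_commute)
    moreover have "card (sym_diff ?S (?B N)) \<le> card (?S - ?B N) + card (?B N - ?S)"
      by (rule card_Un_le)
    ultimately show ?thesis using union card_S by (simp add: algebra_simps)
  qed
  then show ?thesis by blast
qed

text \<open>A diagonal choice: the \<open>n\<close>-th box is almost invariant under the first
  \<open>n\<close> elements of an enumeration, with error \<open>2 / (n + 1)\<close>. A given
  \<open>g = e i\<close> is covered from \<open>n > i\<close> on. \<open>from_nat_into\<close> also
  enumerates a finite group, with repetitions.\<close>

lemma left_Folner_seq_exists:
  assumes "countable (carrier G)"
  shows "\<exists>\<F>. left_Folner_seq G \<F>"
proof -
  define e where "e = from_nat_into (carrier G)"
  have e: "e i \<in> carrier G" for i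
    unfolding e_def by (rule from_nat_into) (use one_closed in blast)
  obtain N where N: "\<And>n i. i < n \<Longrightarrow>
      real (card (sym_diff (e i <#\<^bsub>G\<^esub> power_box e n (N n)) (power_box e n (N n))))
      \<le> 2 * (1 / real (Suc n)) * real (card (power_box e n (N n)))"
    using almost_invariant_power_box[of e "1 / real (Suc n)" n for n, OF e] by (auto, metis)
  define \<F> where "\<F> n = power_box e n (N n)" for n
  have Fin: "\<F> n \<in> Fin G" for n unfolding \<F>_def by (rule power_box_Fin[OF e])
  have "(\<lambda>n. real (card (sym_diff (g <#\<^bsub>G\<^esub> \<F> n) (\<F> n))) / real (card (\<F> n))) \<longlonglongrightarrow> 0"
    if "g \<in> carrier G" for g
  proof (rule Lim_null_comparison)
    obtain i where i: "g = e i"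
      using from_nat_into_surj[OF assms \<open>g \<in> carrier G\<close>] by (auto simp: e_def)
    show "\<forall>\<^sub>F n in sequentially. norm (real (card (sym_diff (g <#\<^bsub>G\<^esub> \<F> n) (\<F> n))) / real (card (\<F> n)))
        \<le> 2 * (1 / real (Suc n))"
      using eventually_gt_at_top[of i]
    proof eventually_elim
      case (elim n)
      have "real (card (\<F> n)) > 0" using Fin[of n] by (auto simp: Fin_def card_gt_0_iff)
      with N[OF elim] show ?case by (simp add: i \<F>_def divide_le_eq)
    qed
    show "(\<lambda>n. 2 * (1 / real (Suc n))) \<longlonglongrightarrow> 0"
      by (rule tendsto_mult_right_zero[OF LIMSEQ_Suc[OF lim_1_over_n]])
  qed
  with Fin show ?thesis unfolding left_Folner_seq_def by blast
qed

end

section \<open>Mean equicontinuity\<close>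

locale compact_comm_group_action = comm_group G for G (structure) +
  fixes X :: "'x::metric_space set" and act :: "'a \<Rightarrow> 'x \<Rightarrow> 'x"
  assumes compact_X: "compact X" and action: "continuous_action G X act"
begin

definition pair_act :: "'a \<Rightarrow> 'x \<times> 'x \<Rightarrow> 'x \<times> 'x" where
  "pair_act g z = (act g (fst z), act g (snd z))"

abbreviation pair_dist :: "'x \<times> 'x \<Rightarrow> real" where
  "pair_dist z \<equiv> dist (fst z) (snd z)"

lemma pair_act_closed: "g \<in> carrier G \<Longrightarrow> z \<in> X \<times> X \<Longrightarrow> pair_act g z \<in> X \<times> X"
  using action group_action.element_image[of G X act]
  by (auto simp: pair_act_def continuous_action_def)

lemma pair_act_mult:
  "g \<in> carrier G \<Longrightarrow> h \<in> carrier G \<Longrightarrow> z \<in> X \<times> X \<Longrightarrow>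
    pair_act (g \<otimes> h) z = pair_act g (pair_act h z)"
  using action group_action.composition_rule[of G X act]
  by (auto simp: pair_act_def continuous_action_def)

lemma continuous_on_pair_act: "g \<in> carrier G \<Longrightarrow> continuous_on (X \<times> X) (pair_act g)"
proof -
  assume "g \<in> carrier G"
  then have act: "continuous_on X (act g)" using action by (simp add: continuous_action_def)
  have "continuous_on (X \<times> X) (\<lambda>z. act g (fst z))" "continuous_on (X \<times> X) (\<lambda>z. act g (snd z))"
    by (rule continuous_on_compose2[OF act]; auto intro: continuous_intros)+
  then show ?thesis unfolding pair_act_def by (rule continuous_on_Pair)
qed

lemma folner_action_pairs: "left_Folner_seq G \<F> \<Longrightarrow> folner_action G (X \<times> X) pair_act \<F>"
  by unfold_locales (assumption | erule (1) pair_act_closed | erule (2) pair_act_mult)+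

lemma pair_dist_bounded:
  obtains M where "\<And>z. z \<in> X \<times> X \<Longrightarrow> \<bar>pair_dist z\<bar> \<le> M"
proof -
  obtain M where "\<forall>x\<in>X. \<forall>y\<in>X. dist x y \<le> M"
    using compact_imp_bounded[OF compact_X] by (auto simp: bounded_two_points)
  then show ?thesis by (intro that[of M]) auto
qed

text \<open>A mean over the right translate of \<open>F\<close> by \<open>g\<close> is the mean over
  \<open>F\<close> at the moved pair, so the supremum over \<open>g\<close> in the Banach distance
  runs over the orbit of \<open>(x, y)\<close>.\<close>

lemma mean_translate:
  assumes F: "F \<subseteq> carrier G" and g: "g \<in> carrier G" and "x \<in> X" "y \<in> X"
  shows "1 / real (card F) * (\<Sum>t\<in>F #> g. dist (act t x) (act t y))
    = mean F pair_act pair_dist (pair_act g (x, y))"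
proof -
  have "F #> g = (\<lambda>t. t \<otimes> g) ` F" by (auto simp: r_coset_def)
  moreover have "inj_on (\<lambda>t. t \<otimes> g) F" using inj_on_subset[OF inj_on_multc[OF g] F] .
  ultimately have "(\<Sum>t\<in>F #> g. dist (act t x) (act t y))
      = (\<Sum>t\<in>F. pair_dist (pair_act (t \<otimes> g) (x, y)))"
    by (simp add: sum.reindex pair_act_def)
  also have "\<dots> = (\<Sum>t\<in>F. pair_dist (pair_act t (pair_act g (x, y))))"
    using assms by (intro sum.cong) (auto simp: pair_act_mult)
  finally show ?thesis by (simp add: mean_def)
qed

lemma Banach_mean_dist_eq:
  assumes "x \<in> X" "y \<in> X"
  shows "Banach_mean_dist G act x y = (INF F\<in>Fin G. SUP g\<in>carrier G.
    ereal (mean F pair_act pair_dist (pair_act g (x, y))))"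
  unfolding Banach_mean_dist_def
  by (intro INF_cong SUP_cong refl arg_cong[of _ _ ereal] mean_translate assms)
     (auto simp: Fin_def)

lemma Besicovitch_mean_dist_eq:
  "Besicovitch_mean_dist \<F> act x y = limsup (\<lambda>n. ereal (mean (\<F> n) pair_act pair_dist (x, y)))"
  by (simp add: Besicovitch_mean_dist_def mean_def pair_act_def)

text \<open>For a fixed \<open>F\<close>, let \<open>s\<close> be the supremum of the
  \<open>F\<close>-means over the orbit of \<open>(x, y)\<close>. Averaging these means over
  \<open>\<F> n\<close> gives at most \<open>s\<close>, and the result differs from the plain mean
  over \<open>\<F> n\<close> by \<open>d n\<close>, which tends to 0.\<close>

lemma Besicovitch_le_Banach:
  assumes "left_Folner_seq G \<F>" and xy: "x \<in> X" "y \<in> X"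
  shows "Besicovitch_mean_dist \<F> act x y \<le> Banach_mean_dist G act x y"
  unfolding Banach_mean_dist_eq[OF xy] Besicovitch_mean_dist_eq
proof (rule INF_greatest)
  fix F assume "F \<in> Fin G"
  then have F: "finite F" "F \<noteq> {}" "F \<subseteq> carrier G" by (auto simp: Fin_def)
  interpret folner_action G "X \<times> X" pair_act \<F> by (rule folner_action_pairs) fact
  obtain M where M: "\<And>z. z \<in> X \<times> X \<Longrightarrow> \<bar>pair_dist z\<bar> \<le> M" using pair_dist_bounded by blast
  let ?u = "\<lambda>g. mean F pair_act pair_dist (pair_act g (x, y))"
  have u_le: "?u g \<le> M" if "g \<in> carrier G" for g
    by (rule order_trans[OF abs_ge_self])
       (use that xy F in \<open>intro abs_mean_le M pair_act_closed; auto\<close>)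
  then have bdd: "bdd_above (?u ` carrier G)" by (rule bdd_aboveI2)
  define s where "s = (SUP g\<in>carrier G. ?u g)"
  define d where "d n = mean (\<F> n) pair_act (mean F pair_act pair_dist) (x, y)
    - mean (\<F> n) pair_act pair_dist (x, y)" for n
  have "d \<longlonglongrightarrow> 0"
    unfolding d_def using xy by (intro mean_mean_tendsto[of _ _ M] F M) auto
  then have "(\<lambda>n. s - d n) \<longlonglongrightarrow> s - 0" by (intro tendsto_diff tendsto_const)
  then have lim: "(\<lambda>n. ereal (s - d n)) \<longlonglongrightarrow> ereal s" by simp
  have "mean (\<F> n) pair_act (mean F pair_act pair_dist) (x, y) \<le> s" for n
    unfolding s_def by (intro mean_le folner_Fin cSUP_upper bdd folner_carrier)
  then have "limsup (\<lambda>n. ereal (mean (\<F> n) pair_act pair_dist (x, y))) \<le> limsup (\<lambda>n. ereal (s - d n))"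
    by (intro Limsup_mono always_eventually) (simp add: d_def)
  also have "\<dots> = ereal s" by (rule lim_imp_Limsup[OF _ lim]) simp
  also have "ereal s = (SUP g\<in>carrier G. ereal (?u g))"
  proof -
    have "(SUP g\<in>carrier G. ereal (?u g)) \<le> ereal M" by (intro SUP_least) (simp add: u_le)
    moreover have "ereal (?u \<one>) \<le> (SUP g\<in>carrier G. ereal (?u g))" by (intro SUP_upper) simp
    ultimately have "\<bar>SUP g\<in>carrier G. ereal (?u g)\<bar> \<noteq> \<infinity>" by auto
    then show ?thesis unfolding s_def by (rule ereal_SUP)
  qed
  finally show "limsup (\<lambda>n. ereal (mean (\<F> n) pair_act pair_dist (x, y)))
    \<le> (SUP g\<in>carrier G. ereal (?u g))" .
qed

lemma Banach_imp_Weyl: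
  assumes "Banach_mean_equicontinuous G X act"
  shows "Weyl_mean_equicontinuous G X act"
proof -
  have "Weyl_mean_dist G act x y \<le> Banach_mean_dist G act x y" if "x \<in> X" "y \<in> X" for x y
    unfolding Weyl_mean_dist_def using that by (auto intro!: SUP_least Besicovitch_le_Banach)
  with assms show ?thesis
    unfolding Banach_mean_equicontinuous_def Weyl_mean_equicontinuous_def
    by (meson order_le_less_trans)
qed

lemma Weyl_imp_Besicovitch:
  assumes "Weyl_mean_equicontinuous G X act" "left_Folner_seq G \<F>"
  shows "Besicovitch_mean_equicontinuous \<F> X act"
proof -
  have "Besicovitch_mean_dist \<F> act x y \<le> Weyl_mean_dist G act x y" for x y
    unfolding Weyl_mean_dist_def using assms(2) by (auto intro: SUP_upper)
  with assms(1) show ?thesis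
    unfolding Besicovitch_mean_equicontinuous_def Weyl_mean_equicontinuous_def
    by (meson order_le_less_trans)
qed

text \<open>The pairs in \<open>X \<times> X\<close> with Besicovitch distance at most
  \<open>c\<close>, in the real-valued form that \<open>uniform_mean_bound\<close> takes as
  hypothesis.\<close>

definition mean_close_pairs :: "(nat \<Rightarrow> 'a set) \<Rightarrow> real \<Rightarrow> ('x \<times> 'x) set" where
  "mean_close_pairs \<F> c = {z \<in> X \<times> X. \<forall>\<eta>>0.
     \<forall>\<^sub>F n in sequentially. mean (\<F> n) pair_act pair_dist z \<le> c + \<eta>}"

lemma mean_close_pairsI:
  assumes "x \<in> X" "y \<in> X" "Besicovitch_mean_dist \<F> act x y < ereal c"
  shows "(x, y) \<in> mean_close_pairs \<F> c"
proof -
  have "\<forall>\<^sub>F n in sequentially. ereal (mean (\<F> n) pair_act pair_dist (x, y)) < ereal c"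
    using assms(3) unfolding Besicovitch_mean_dist_eq by (rule Limsup_lessD)
  then have "\<forall>\<^sub>F n in sequentially. mean (\<F> n) pair_act pair_dist (x, y) \<le> c + \<eta>" if "\<eta> > 0" for \<eta>
    using that by (elim eventually_mono) simp
  with assms show ?thesis by (simp add: mean_close_pairs_def)
qed

text \<open>If \<open>z'\<close> in the set is close to \<open>z\<close>, the triangle inequality
  bounds the mean at \<open>z\<close> by the mean at \<open>z'\<close> plus the means at the pairs
  of first and of second coordinates. Equicontinuity makes the last two eventually smaller than
  \<open>\<eta> / 3\<close>.\<close>

lemma closed_mean_close_pairs:
  assumes "Besicovitch_mean_equicontinuous \<F> X act"
  shows "closed (mean_close_pairs \<F> c)"
proof -
  have "closed (X \<times> X)" by (intro closed_Times compact_imp_closed compact_X)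
  then have closure_subset: "closure (mean_close_pairs \<F> c) \<subseteq> X \<times> X"
    by (intro closure_minimal) (auto simp: mean_close_pairs_def)
  have "z \<in> mean_close_pairs \<F> c" if z: "z \<in> closure (mean_close_pairs \<F> c)" for z
    unfolding mean_close_pairs_def
  proof (intro CollectI conjI allI impI)
    show "z \<in> X \<times> X" using z closure_subset by blast
    fix \<eta> :: real assume "\<eta> > 0"
    then have "\<eta> / 3 > 0" by simp
    with assms obtain \<delta> where "\<delta> > 0"
      and \<delta>: "\<And>x y. x \<in> X \<Longrightarrow> y \<in> X \<Longrightarrow> dist x y < \<delta> \<Longrightarrow>
        \<forall>\<^sub>F n in sequentially. ereal (mean (\<F> n) pair_act pair_dist (x, y)) < ereal (\<eta> / 3)"
      unfolding Besicovitch_mean_equicontinuous_def Besicovitch_mean_dist_eq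
      by (blast dest: Limsup_lessD)
    obtain z' where z': "z' \<in> mean_close_pairs \<F> c" "dist z' z < \<delta>"
      using z \<open>\<delta> > 0\<close> closure_approachable by blast
    have "dist (fst z) (fst z') < \<delta>" "dist (snd z) (snd z') < \<delta>"
      using z'(2) dist_fst_le[of z' z] dist_snd_le[of z' z] by (auto simp: dist_commute)
    moreover have "z \<in> X \<times> X" "z' \<in> X \<times> X"
      using \<open>z \<in> X \<times> X\<close> z' by (auto simp: mean_close_pairs_def)
    ultimately have
      "\<forall>\<^sub>F n in sequentially. ereal (mean (\<F> n) pair_act pair_dist (fst z, fst z')) < ereal (\<eta> / 3)"
      "\<forall>\<^sub>F n in sequentially. ereal (mean (\<F> n) pair_act pair_dist (snd z, snd z')) < ereal (\<eta> / 3)"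
      by (intro \<delta>; simp add: mem_Times_iff)+
    moreover have "\<forall>\<^sub>F n in sequentially. mean (\<F> n) pair_act pair_dist z' \<le> c + \<eta> / 3"
      using z'(1) \<open>\<eta> / 3 > 0\<close> unfolding mean_close_pairs_def by blast
    ultimately show "\<forall>\<^sub>F n in sequentially. mean (\<F> n) pair_act pair_dist z \<le> c + \<eta>"
    proof eventually_elim
      case (elim n)
      have triangle: "dist a b \<le> dist a a' + dist b b' + dist a' b'" for a b a' b' :: 'x
        using dist_triangle[of a b a'] dist_triangle[of a' b b'] by (simp add: dist_commute)
      have "mean (\<F> n) pair_act pair_dist z \<le> mean (\<F> n) pair_act pair_dist (fst z, fst z')
          + mean (\<F> n) pair_act pair_dist (snd z, snd z') + mean (\<F> n) pair_act pair_dist z'"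
        unfolding mean_def add_divide_distrib[symmetric] sum.distrib[symmetric]
        by (intro divide_right_mono sum_mono) (auto simp: pair_act_def intro: triangle)
      also have "\<dots> \<le> \<eta> / 3 + \<eta> / 3 + (c + \<eta> / 3)"
        by (intro add_mono less_imp_le elim(1,2)[unfolded less_ereal.simps] elim(3))
      finally show ?case by simp
    qed
  qed
  then show ?thesis by (intro closure_subset_eq[THEN iffD1] subsetI)
qed

text \<open>Commutativity of \<open>G\<close> turns the mean along \<open>h z\<close> into a mean along \<open>z\<close> of the function
  \<open>d \<circ> h\<close>, to which the left Folner property applies.\<close>

lemma mean_close_pairs_invariant:
  assumes "left_Folner_seq G \<F>" and h: "h \<in> carrier G" and z: "z \<in> mean_close_pairs \<F> c"
  shows "pair_act h z \<in> mean_close_pairs \<F> c"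
  unfolding mean_close_pairs_def
proof (intro CollectI conjI allI impI)
  interpret folner_action G "X \<times> X" pair_act \<F> by (rule folner_action_pairs) fact
  have zX: "z \<in> X \<times> X" using z by (simp add: mean_close_pairs_def)
  show "pair_act h z \<in> X \<times> X" using h zX by (rule pair_act_closed)
  fix \<eta> :: real assume "\<eta> > 0"
  obtain M where M: "\<And>z. z \<in> X \<times> X \<Longrightarrow> \<bar>pair_dist z\<bar> \<le> M" using pair_dist_bounded by blast
  let ?r = "\<lambda>n. M * (real (card (sym_diff (h <#\<^bsub>G\<^esub> \<F> n) (\<F> n))) / real (card (\<F> n)))"
  have "?r \<longlonglongrightarrow> 0"
    using assms(1) h by (intro tendsto_mult_right_zero) (auto simp: left_Folner_seq_def)
  then have "\<forall>\<^sub>F n in sequentially. ?r n < \<eta> / 2" using \<open>\<eta> > 0\<close> by (intro order_tendstoD) auto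
  moreover have "\<forall>\<^sub>F n in sequentially. mean (\<F> n) pair_act pair_dist z \<le> c + \<eta> / 2"
    using z \<open>\<eta> > 0\<close> by (simp add: mean_close_pairs_def)
  ultimately show "\<forall>\<^sub>F n in sequentially. mean (\<F> n) pair_act pair_dist (pair_act h z) \<le> c + \<eta>"
  proof eventually_elim
    case (elim n)
    have "mean (\<F> n) pair_act pair_dist (pair_act h z)
        = mean (\<F> n) pair_act (\<lambda>z. pair_dist (pair_act h z)) z"
      unfolding mean_def
      by (intro arg_cong2[of _ _ _ _ "(/)"] sum.cong refl)
         (metis pair_act_mult h zX folner_carrier m_comm)
    with elim mean_shift_diff[where \<phi> = pair_dist and n = n, OF h zX M] show ?case by linarith
  qed
qed

lemma Besicovitch_imp_Banach:
  assumes folner: "left_Folner_seq G \<F>" and equi: "Besicovitch_mean_equicontinuous \<F> X act"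
  shows "Banach_mean_equicontinuous G X act"
  unfolding Banach_mean_equicontinuous_def
proof (intro allI impI)
  fix \<epsilon> :: real assume "\<epsilon> > 0"
  \<comment> \<open>The level \<open>c\<close> and the loss \<open>\<eta> = c\<close> in
    \<open>uniform_mean_bound\<close> add up to \<open>2 * \<epsilon> / 3\<close>, leaving room for
    the strict inequality.\<close>
  define c where "c = \<epsilon> / 3"
  have "c > 0" using \<open>\<epsilon> > 0\<close> by (simp add: c_def)
  then obtain \<delta> where "\<delta> > 0"
    and \<delta>: "\<And>x y. x \<in> X \<Longrightarrow> y \<in> X \<Longrightarrow> dist x y < \<delta> \<Longrightarrow> Besicovitch_mean_dist \<F> act x y < ereal c"
    using equi unfolding Besicovitch_mean_equicontinuous_def by blast
  let ?K = "mean_close_pairs \<F> c"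
  have K_X: "?K \<subseteq> X \<times> X" by (auto simp: mean_close_pairs_def)
  have "Banach_mean_dist G act x y < ereal \<epsilon>" if xy: "x \<in> X" "y \<in> X" "dist x y < \<delta>" for x y
  proof -
    interpret folner_action G ?K pair_act \<F>
      by unfold_locales
         (use K_X in \<open>auto simp: folner pair_act_mult mean_close_pairs_invariant[OF folner]\<close>)
    have xy_K: "(x, y) \<in> ?K" using xy by (intro mean_close_pairsI \<delta>)
    have "?K = (X \<times> X) \<inter> ?K" using K_X by blast
    then have "compact ?K"
      using compact_Int_closed[OF compact_Times[OF compact_X compact_X]
          closed_mean_close_pairs[OF equi, of c]] by simp
    moreover have "continuous_on ?K (pair_act g)" if "g \<in> carrier G" for g
      using continuous_on_pair_act[OF that] K_X by (rule continuous_on_subset)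
    moreover have "\<forall>\<^sub>F n in sequentially. mean (\<F> n) pair_act pair_dist z \<le> c + \<eta>"
      if "z \<in> ?K" "\<eta> > 0" for z \<eta>
      using that by (simp add: mean_close_pairs_def)
    moreover have "continuous_on ?K pair_dist" by (intro continuous_intros)
    ultimately obtain j where j: "\<forall>z\<in>?K. mean (\<F> j) pair_act pair_dist z \<le> c + c"
      using uniform_mean_bound[of pair_dist c c] xy_K \<open>c > 0\<close> by blast
    \<comment> \<open>The set \<open>\<F> j\<close> is the competitor in the infimum; invariance
      keeps the whole orbit of \<open>(x, y)\<close> in \<open>?K\<close>, where the uniform bound
      holds.\<close>
    have "Banach_mean_dist G act x y
        \<le> (SUP g\<in>carrier G. ereal (mean (\<F> j) pair_act pair_dist (pair_act g (x, y))))"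
      unfolding Banach_mean_dist_eq[OF xy(1,2)]
      by (rule INF_lower) (use folner in \<open>simp add: left_Folner_seq_def\<close>)
    also have "\<dots> \<le> ereal (c + c)"
      using j T_closed[OF _ xy_K] by (intro SUP_least) simp
    also have "\<dots> < ereal \<epsilon>" using \<open>\<epsilon> > 0\<close> by (simp add: c_def)
    finally show ?thesis .
  qed
  with \<open>\<delta> > 0\<close> show "\<exists>\<delta>>0. \<forall>x\<in>X. \<forall>y\<in>X. dist x y < \<delta> \<longrightarrow>
      Banach_mean_dist G act x y < ereal \<epsilon>" by blast
qed

end

theorem theorem4p5:
  fixes G :: "('g, 'm) monoid_scheme"
    and X :: "'x::metric_space set"
    and act :: "'g \<Rightarrow> 'x \<Rightarrow> 'x"
  assumes "comm_group G"
    and "countable (carrier G)"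
    and "compact X"
    and "continuous_action G X act"
  shows "(Banach_mean_equicontinuous G X act \<longleftrightarrow> Weyl_mean_equicontinuous G X act) \<and>
         (Weyl_mean_equicontinuous G X act \<longleftrightarrow>
            (\<exists>\<F>. left_Folner_seq G \<F> \<and> Besicovitch_mean_equicontinuous \<F> X act))"
proof -
  interpret compact_comm_group_action G X act
    using assms by (simp add: compact_comm_group_action_def compact_comm_group_action_axioms_def)
  show ?thesis
    using left_Folner_seq_exists[OF assms(2)] Banach_imp_Weyl Weyl_imp_Besicovitch
      Besicovitch_imp_Banach by blast
qed

end
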